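(* Let $n\ge 1$, let $\mathbb{V}$ be an $n$-dimensional vector space over a field $\mathbb{F}$ and let $\mathcal{B}=\{v_1,\dots,v_n\}$ be a basis of $\mathbb{V}$. Then $\mathbb{IG(V)}\cong\Gamma^c(\mathbb{F}^n)\vee K_t$, where $t=|V_{12\cdots n}|=(|\mathbb{F}|-1)^n$.
   Context: All graphs are simple. For $a=a_1v_1+\dots+a_nv_n\in\mathbb{V}$, let $S_{\mathcal{B}}(a)=\{v_i\mid a_i\neq 0\}$. The nonzero component graph $\mathbb{IG(V)}$ (with respect to $\mathcal{B}$) has vertex set $\mathbb{V}\setminus\{0\}$, with distinct $a,b$ adjacent iff $S_{\mathcal{B}}(a)\cap S_{\mathcal{B}}(b)\neq\emptyset$. $V_{12\cdots n}=\{a\in\mathbb{V}\mid a_i\ne 0\text{ for all } i\in\{1,\dots,n\}\}$. $\mathbb{F}^n$ is regarded as a ring, the direct product of $n$ copies of $\mathbb{F}$. For a commutative ring $R$ with unity, the zero-divisor graph $\Gamma(R)$ has as vertices the nonzero zero-divisors of $R$ (possibly none), with distinct $x,y$ adjacent iff $xy=0$; $\Gamma^c(R)$ is its complement. The join $G\vee H$ is formed from disjoint copies of $G$ and $H$ by joining every vertex of $G$ to every vertex of $H$. $K_t$ is the complete graph on $t$ vertices ($t$ may be an infinite cardinal). *)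

theory Defs
  imports
    "HOL-Analysis.Cartesian_Space"
    "Graph_Theory.Pair_Digraph"
    "Graph_Theory.Digraph_Isomorphism"
begin

unbundle cardinal_syntax

section \<open>Simple graphs\<close>

text \<open>
  As in \<^theory>\<open>Graph_Theory.Digraph\<close>, an undirected graph is a symmetric digraph. A simple graph,
  possibly infinite, is an instance of \<^locale>\<open>pair_bidirected_digraph\<close> (symmetric, loop-free,
  arcs given by pairs of vertices), and isomorphism is \<^const>\<open>digraph_iso\<close>.
\<close>

definition graph_complement :: "'a pair_pre_digraph \<Rightarrow> 'a pair_pre_digraph" where
  "graph_complement G =
     \<lparr>pverts = pverts G,
      parcs = {(x, y). x \<in> pverts G \<and> y \<in> pverts G \<and> x \<noteq> y \<and> (x, y) \<notin> parcs G}\<rparr>"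

definition graph_join ::
  "'a pair_pre_digraph \<Rightarrow> 'b pair_pre_digraph \<Rightarrow> ('a + 'b) pair_pre_digraph" where
  "graph_join G H =
     \<lparr>pverts = pverts G <+> pverts H,
      parcs = {(Inl x, Inl y) | x y. (x, y) \<in> parcs G}
            \<union> {(Inr x, Inr y) | x y. (x, y) \<in> parcs H}
            \<union> {(Inl x, Inr y) | x y. x \<in> pverts G \<and> y \<in> pverts H}
            \<union> {(Inr y, Inl x) | x y. x \<in> pverts G \<and> y \<in> pverts H}\<rparr>"

text \<open>
  A cardinal \<open>t\<close> is a cardinal order in the sense of \<^const>\<open>card_order_on\<close>; its field is a set of
  cardinality \<open>t\<close>, which serves as the vertex set of $K_t$.
\<close>

definition complete_graph :: "'a rel \<Rightarrow> 'a pair_pre_digraph" where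
  "complete_graph t =
     \<lparr>pverts = Field t, parcs = {(x, y). x \<in> Field t \<and> y \<in> Field t \<and> x \<noteq> y}\<rparr>"

section \<open>The zero-divisor graph of a commutative ring\<close>

definition zero_divisors :: "'r::comm_ring_1 set" where
  "zero_divisors = {x. \<exists>y. y \<noteq> 0 \<and> x * y = 0}"

definition zero_divisor_graph :: "'r::comm_ring_1 pair_pre_digraph" where
  "zero_divisor_graph =
     \<lparr>pverts = zero_divisors - {0},
      parcs = {(x, y). x \<in> zero_divisors - {0} \<and> y \<in> zero_divisors - {0} \<and> x \<noteq> y \<and> x * y = 0}\<rparr>"

section \<open>The nonzero component graph of a vector space\<close>

text \<open>
  The basis is the family \<open>v\<close>, indexed by a finite type. For a basis, \<open>coordinate smul v a i\<close> is the
  coefficient $a_i$ in $a = \sum_i a_i v_i$.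
\<close>

definition coordinate ::
  "('f::field \<Rightarrow> 'v::ab_group_add \<Rightarrow> 'v) \<Rightarrow> ('n \<Rightarrow> 'v) \<Rightarrow> 'v \<Rightarrow> 'n \<Rightarrow> 'f" where
  "coordinate smul v a i = module.representation smul (range v) a (v i)"

definition skeleton ::
  "('f::field \<Rightarrow> 'v::ab_group_add \<Rightarrow> 'v) \<Rightarrow> ('n \<Rightarrow> 'v) \<Rightarrow> 'v \<Rightarrow> 'v set" where
  "skeleton smul v a = {v i | i. coordinate smul v a i \<noteq> 0}"

definition full_vectors ::
  "('f::field \<Rightarrow> 'v::ab_group_add \<Rightarrow> 'v) \<Rightarrow> ('n \<Rightarrow> 'v) \<Rightarrow> 'v set" where
  "full_vectors smul v = {a. \<forall>i. coordinate smul v a i \<noteq> 0}"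

definition nonzero_component_graph ::
  "('f::field \<Rightarrow> 'v::ab_group_add \<Rightarrow> 'v) \<Rightarrow> ('n \<Rightarrow> 'v) \<Rightarrow> 'v pair_pre_digraph" where
  "nonzero_component_graph smul v =
     \<lparr>pverts = UNIV - {0},
      parcs = {(a, b). a \<noteq> 0 \<and> b \<noteq> 0 \<and> a \<noteq> b \<and> skeleton smul v a \<inter> skeleton smul v b \<noteq> {}}\<rparr>"

section \<open>Subtracting one from a cardinal\<close>

text \<open>
  For a nonzero cardinal \<open>r\<close>, \<open>cpred r\<close> is the cardinal \<open>r - 1\<close>: one element is removed from the
  field. If \<open>r\<close> is infinite, then \<open>r - 1\<close> is \<open>r\<close>.
\<close>

definition cpred :: "'a rel \<Rightarrow> 'a rel" where
  "cpred r = |Field r - {SOME x. x \<in> Field r}|"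

lemma cpred_csum_cone:
  assumes "Card_order r" and "Field r \<noteq> {}"
  shows "cpred r +c cone =o r"
proof -
  define x where "x = (SOME x. x \<in> Field r)"
  have x: "x \<in> Field r"
    using assms(2) unfolding x_def by (simp add: some_in_eq)
  have "bij_betw (case_sum id (\<lambda>_. x)) ((Field r - {x}) <+> {()}) (Field r)"
    using x by (auto simp: bij_betw_def inj_on_def Plus_def image_Un image_image)
  then have "|(Field r - {x}) <+> {()}| =o |Field r|"
    using card_of_ordIso by blast
  then have "|(Field r - {x}) <+> {()}| =o r"
    using card_of_Field_ordIso[OF assms(1)] ordIso_transitive by blast
  then show ?thesis
    by (simp add: cpred_def csum_def cone_def Field_card_of x_def)
qed

lemma card_cpred_cexp:
  assumes "finite A" and "A \<noteq> {}" and "finite B"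
  shows "card (Field (cpred |A| ^c |B| )) = (card A - 1) ^ card B"
proof -
  define x where "x = (SOME x. x \<in> A)"
  have x: "x \<in> A"
    using assms(2) unfolding x_def by (simp add: some_in_eq)
  have *: "bij_betw (\<lambda>f. restrict f B) (Func B (A - {x})) (B \<rightarrow>\<^sub>E (A - {x}))"
  proof (rule bij_betw_byWitness[where f' = "\<lambda>f a. if a \<in> B then f a else undefined"])
  qed (auto simp: Func_def fun_eq_iff PiE_def extensional_def)
  have "card (Field (cpred |A| ^c |B| )) = card (Func B (A - {x}))"
    by (simp add: cpred_def cexp_def Field_card_of x_def)
  also have "\<dots> = card (B \<rightarrow>\<^sub>E (A - {x}))"
    using bij_betw_same_card[OF *] .
  also have "\<dots> = (card A - 1) ^ card B"
    using assms x by (simp add: card_PiE)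
  finally show ?thesis .
qed

section \<open>Well-formedness\<close>

lemma simple_graph_complement:
  assumes "pair_bidirected_digraph G"
  shows "pair_bidirected_digraph (graph_complement G)"
proof -
  have "sym (parcs G)"
    using assms by (auto simp: pair_bidirected_digraph_def pair_sym_digraph_def
        pair_sym_digraph_axioms_def symmetric_def)
  then show ?thesis
    by unfold_locales (auto simp: graph_complement_def symmetric_def sym_def)
qed

lemma simple_graph_join:
  assumes "pair_bidirected_digraph G" and "pair_bidirected_digraph H"
  shows "pair_bidirected_digraph (graph_join G H)"
proof -
  interpret G: pair_bidirected_digraph G by fact
  interpret H: pair_bidirected_digraph H by fact
  have "sym (parcs G)" "sym (parcs H)"
    using G.pair_sym_arcs H.pair_sym_arcs by (auto simp: symmetric_def)
  moreover have "(x, x) \<notin> parcs G" "(y, y) \<notin> parcs H" for x y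
    using G.pair_no_loops[of "(x, x)"] H.pair_no_loops[of "(y, y)"] by auto
  ultimately show ?thesis
    by unfold_locales
      (auto simp: graph_join_def symmetric_def sym_def dest: G.wellformed' H.wellformed')
qed

lemma simple_complete_graph: "pair_bidirected_digraph (complete_graph t)"
  by unfold_locales (auto simp: complete_graph_def symmetric_def sym_def)

lemma simple_zero_divisor_graph: "pair_bidirected_digraph zero_divisor_graph"
  by unfold_locales (auto simp: zero_divisor_graph_def symmetric_def sym_def mult.commute)

lemma simple_nonzero_component_graph: "pair_bidirected_digraph (nonzero_component_graph smul v)"
  by unfold_locales (auto simp: nonzero_component_graph_def symmetric_def sym_def)

end

(* Taking coordinates identifies V with F^n, the zero vector with 0, and "the skeletons meet" with
   "the pointwise product is nonzero". A nonzero element of F^n is a zero-divisor iff some coordinate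
   vanishes, so the nonzero vectors split into the vertices of the zero-divisor graph, on which
   adjacency is that of its complement, and the full vectors, each adjacent to everything. *)

theory Submission
  imports Defs
begin

text \<open>Since arcs are pairs of vertices, a vertex bijection that preserves and reflects arcs
  forces the arc map, so no separate bijection of arcs has to be supplied.\<close>

lemma digraph_iso_with_projI:
  assumes "pair_wf_digraph G" and "pair_wf_digraph H"
    and bij: "bij_betw h (pverts G) (pverts H)"
    and arcs: "\<And>x y. x \<in> pverts G \<Longrightarrow> y \<in> pverts G \<Longrightarrow> (h x, h y) \<in> parcs H \<longleftrightarrow> (x, y) \<in> parcs G"
  shows "digraph_iso (with_proj G) (with_proj H)"
proof -
  interpret G: pair_wf_digraph G by fact
  interpret H: pair_wf_digraph H by fact
  \<comment> \<open>\<open>iso_head\<close> and \<open>iso_tail\<close> become the end maps of the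
    image graph; the projections are what \<open>with_proj H\<close> requires.\<close>
  let ?f = "\<lparr>iso_verts = h, iso_arcs = map_prod h h, iso_head = snd, iso_tail = fst\<rparr>"
  have sub: "parcs G \<subseteq> pverts G \<times> pverts G"
    by (auto dest: G.wellformed')
  have inj: "inj_on h (pverts G)" and img: "h ` pverts G = pverts H"
    using bij by (auto simp: bij_betw_def)
  have "inj_on (map_prod h h) (parcs G)"
    using inj_on_subset[OF map_prod_inj_on[OF inj inj] sub] .
  moreover have "map_prod h h ` parcs G = parcs H"
  proof (intro equalityI subsetI)
    fix e assume "e \<in> map_prod h h ` parcs G"
    then show "e \<in> parcs H"
      using sub arcs by auto
  next
    \<comment> \<open>Well-formedness of \<open>H\<close> puts both ends of \<open>e\<close> in the
      image of \<open>h\<close>, so the arc can be pulled back.\<close>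
    fix e assume e: "e \<in> parcs H"
    then have "fst e \<in> h ` pverts G" "snd e \<in> h ` pverts G"
      unfolding img by (cases e; auto dest: H.wellformed')+
    then obtain x y where xy: "x \<in> pverts G" "y \<in> pverts G" "e = (h x, h y)"
      by (metis imageE prod.collapse)
    then have "(x, y) \<in> parcs G"
      using e arcs by auto
    then show "e \<in> map_prod h h ` parcs G"
      using xy by (auto intro!: rev_image_eqI)
  qed
  ultimately have "pre_digraph.digraph_isomorphism (with_proj G) ?f"
    and "with_proj H = app_iso ?f (with_proj G)"
    using inj img G.wf_digraph_axioms
    by (auto simp: pre_digraph.digraph_isomorphism_def app_iso_def with_proj_def)
  then show ?thesis
    by (auto simp: digraph_iso_def)
qed

text \<open>Where an annihilated \<open>y\<close> has a nonzero coordinate, \<open>x\<close> must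
  vanish, because a field has no zero-divisors. Conversely, the unit vector at a vanishing
  coordinate of \<open>x\<close> annihilates \<open>x\<close>.\<close>

lemma zero_divisors_vec:
  "(zero_divisors :: ('f::field ^ 'n) set) = {x. \<exists>i. x $ i = 0}"
proof (intro equalityI subsetI)
  fix x :: "'f ^ 'n" assume "x \<in> zero_divisors"
  then obtain y where "y \<noteq> 0" "x * y = 0"
    unfolding zero_divisors_def by blast
  moreover from \<open>y \<noteq> 0\<close> obtain i where "y $ i \<noteq> 0"
    unfolding vec_eq_iff by (metis zero_index)
  moreover have "x $ i * y $ i = (x * y) $ i"
    by simp
  ultimately show "x \<in> {x. \<exists>i. x $ i = 0}"
    by (metis (mono_tags, lifting) mem_Collect_eq mult_eq_0_iff zero_index)
next
  fix x :: "'f ^ 'n" assume "x \<in> {x. \<exists>i. x $ i = 0}"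
  then obtain i where "x $ i = 0" by auto
  have "axis i 1 \<noteq> (0 :: 'f ^ 'n)"
    by (simp add: axis_eq_0_iff)
  moreover have "(x * axis i 1) $ j = 0 $ j" for j
    using \<open>x $ i = 0\<close> by (cases "j = i") (simp_all add: axis_def)
  then have "x * axis i 1 = 0"
    unfolding vec_eq_iff by blast
  ultimately show "x \<in> zero_divisors"
    unfolding zero_divisors_def by blast
qed

text \<open>The inverse sends \<open>x\<close> to the linear combination of the basis with
  coefficients \<open>x $ i\<close>. Injectivity of \<open>v\<close> allows sums over
  \<open>range v\<close> to be indexed by \<open>'n\<close>.\<close>

lemma bij_coordinates:
  fixes smul :: "'f::field \<Rightarrow> 'v::ab_group_add \<Rightarrow> 'v" and v :: "'n::finite \<Rightarrow> 'v"
  assumes "vector_space smul" and inj: "inj v"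
    and indep: "\<not> module.dependent smul (range v)"
    and span: "module.span smul (range v) = UNIV"
  shows "bij (\<lambda>a. \<chi> i. coordinate smul v a i)"
proof -
  interpret vector_space smul by fact
  let ?c = "\<lambda>a. \<chi> i. coordinate smul v a i"
  have sum: "(\<Sum>i\<in>UNIV. smul (coordinate smul v a i) (v i)) = a" for a
  proof -
    have "(\<Sum>i\<in>UNIV. smul (coordinate smul v a i) (v i))
        = (\<Sum>b\<in>range v. smul (representation (range v) a b) b)"
      by (simp add: sum.reindex[OF inj] coordinate_def)
    also have "\<dots> = a"
      by (rule sum_representation_eq) (use indep span in simp_all)
    finally show ?thesis .
  qed
  have "inj ?c"
  proof (rule injI)
    fix a b assume "?c a = ?c b"
    then have "coordinate smul v a = coordinate smul v b"
      by (simp add: vec_eq_iff fun_eq_iff)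
    then show "a = b"
      by (metis sum)
  qed
  moreover have "?c (\<Sum>i\<in>UNIV. smul (x $ i) (v i)) = x" for x
  proof -
    have "coordinate smul v (\<Sum>i\<in>UNIV. smul (x $ i) (v i)) j = x $ j" for j
    proof -
      have "representation (range v) (\<Sum>i\<in>UNIV. smul (x $ i) (v i)) (v j)
          = (\<Sum>i\<in>UNIV. x $ i * representation (range v) (v i) (v j))"
        by (simp add: representation_sum[OF indep] representation_scale[OF indep] span)
      \<comment> \<open>A basis vector represents itself with coefficient 1, and
        \<open>v i = v j\<close> only for \<open>i = j\<close>, so a Kronecker delta
        remains.\<close>
      also have "\<dots> = (\<Sum>i\<in>UNIV. if i = j then x $ i else 0)"
        by (intro sum.cong refl) (simp add: representation_basis[OF indep] inj_eq[OF inj])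
      finally show ?thesis
        by (simp add: coordinate_def)
    qed
    then show ?thesis by (simp add: vec_eq_iff)
  qed
  then have "surj ?c"
    by (rule surjI)
  ultimately show ?thesis
    by (rule bijI)
qed

lemma coordinate_zero:
  assumes "vector_space smul"
  shows "coordinate smul v 0 i = 0"
proof -
  interpret vector_space smul by fact
  show ?thesis
    by (simp add: coordinate_def representation_zero)
qed

lemma card_of_full_vectors:
  fixes smul :: "'f::field \<Rightarrow> 'v::ab_group_add \<Rightarrow> 'v" and v :: "'n::finite \<Rightarrow> 'v"
  assumes "bij (\<lambda>a. \<chi> i. coordinate smul v a i)"
  shows "|full_vectors smul v| =o cpred |UNIV :: 'f set| ^c |UNIV :: 'n set|"
proof -
  \<comment> \<open>\<^const>\<open>cpred\<close> removes an arbitrary element \<open>z\<close> of the field instead of \<open>0\<close>, so coordinates are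
    translated by \<open>z\<close>.\<close>
  define z :: 'f where "z = (SOME x. x \<in> UNIV)"
  let ?g = "\<lambda>a i. coordinate smul v a i + z"
  have "bij_betw ?g (full_vectors smul v) (Func UNIV (UNIV - {z}))"
  proof (rule bij_betw_imageI)
    show "inj_on ?g (full_vectors smul v)"
      using bij_is_inj[OF assms] by (auto simp: inj_on_def vec_eq_iff fun_eq_iff)
    have "f \<in> ?g ` full_vectors smul v" if f: "\<And>i. f i \<noteq> z" for f
    proof -
      \<comment> \<open>Undoing the translation: \<open>f i - z\<close> is nonzero exactly because
        \<open>f\<close> avoids \<open>z\<close>.\<close>
      obtain a where "(\<chi> i. coordinate smul v a i) = (\<chi> i. f i - z)"
        using bij_is_surj[OF assms] by (metis surjD)
      then have "coordinate smul v a i = f i - z" for i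
        by (simp add: vec_eq_iff)
      then show ?thesis
        using f by (intro image_eqI[of _ _ a]) (auto simp: full_vectors_def)
    qed
    then show "?g ` full_vectors smul v = Func UNIV (UNIV - {z})"
      by (auto simp: Func_def full_vectors_def)
  qed
  then have "|full_vectors smul v| =o |Func (UNIV :: 'n set) (UNIV - {z})|"
    using card_of_ordIso by blast
  then show ?thesis
    by (simp add: cexp_def cpred_def Field_card_of z_def)
qed

text \<open>Any bijection \<open>k\<close> serves: distinct full vectors are always adjacent, as are
  distinct vertices of the complete graph.\<close>

lemma nonzero_component_graph_iso_join:
  fixes smul :: "'f::field \<Rightarrow> 'v::ab_group_add \<Rightarrow> 'v" and v :: "'n::finite \<Rightarrow> 'v"
  assumes "vector_space smul" and inj: "inj v"
    and bij: "bij (\<lambda>a. \<chi> i. coordinate smul v a i)"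
    and k: "bij_betw k (full_vectors smul v) (Field t)"
  shows "digraph_iso
      (with_proj (nonzero_component_graph smul v))
      (with_proj (graph_join
        (graph_complement (zero_divisor_graph :: ('f ^ 'n) pair_pre_digraph))
        (complete_graph t)))"
proof -
  let ?G = "nonzero_component_graph smul v"
  let ?Z = "zero_divisor_graph :: ('f ^ 'n) pair_pre_digraph"
  let ?J = "graph_join (graph_complement ?Z) (complete_graph t)"
  define F where "F = full_vectors smul v"
  define c where "c a = (\<chi> i. coordinate smul v a i)" for a
  define h where "h a = (if a \<in> F then Inr (k a) else Inl (c a))" for a
  have c_eq: "c a = c b \<longleftrightarrow> a = b" for a b
    using bij_is_inj[OF bij] by (auto simp: c_def inj_on_def)
  have c_0: "c 0 = 0"
    by (simp add: c_def vec_eq_iff coordinate_zero[OF assms(1)])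
  have F: "a \<in> F \<longleftrightarrow> (\<forall>i. c a $ i \<noteq> 0)" for a
    by (simp add: F_def full_vectors_def c_def)
  \<comment> \<open>The index type is nonempty, so the zero vector has a vanishing coordinate; here
    n \<ge> 1 enters.\<close>
  have F0: "a \<noteq> 0" if "a \<in> F" for a
    using that F[of 0] c_0 by auto
  have zd: "c a \<in> zero_divisors - {0} \<longleftrightarrow> a \<notin> F \<and> a \<noteq> 0" for a
    using c_eq[of a 0] c_0 by (auto simp: zero_divisors_vec F)
  \<comment> \<open>As \<open>v\<close> is injective, a shared basis vector is a shared index, at
    which the product of the two coordinates is nonzero.\<close>
  have skel: "skeleton smul v a \<inter> skeleton smul v b \<noteq> {} \<longleftrightarrow> c a * c b \<noteq> 0" for a b
    using inj by (auto simp: skeleton_def c_def vec_eq_iff inj_eq)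
  \<comment> \<open>At a nonzero coordinate of \<open>b\<close>, the coordinate of \<open>a\<close>
    is nonzero too.\<close>
  have full: "c a * c b \<noteq> 0" if "a \<in> F" "b \<noteq> 0" for a b
    using that c_eq[of b 0] c_0 by (auto simp: F vec_eq_iff)
  have kF: "k ` F = Field t" "inj_on k F"
    using k by (auto simp: bij_betw_def F_def)
  have vJ: "pverts ?J = (zero_divisors - {0}) <+> Field t"
    by (simp add: graph_join_def graph_complement_def zero_divisor_graph_def complete_graph_def)
  have "bij_betw h (UNIV - {0}) (pverts ?J)"
  proof (rule bij_betw_imageI)
    show "inj_on h (UNIV - {0})"
      using kF(2) by (auto simp: inj_on_def h_def c_eq split: if_splits)
    have "x \<in> h ` (UNIV - {0})" if "x \<in> pverts ?J" for x
    proof (cases x)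
      case (Inl y)
      obtain a where a: "y = c a"
        using bij_is_surj[OF bij] unfolding c_def by (metis surjD)
      then have "a \<notin> F \<and> a \<noteq> 0"
        using that Inl zd[of a] by (auto simp: vJ)
      then show ?thesis
        using Inl a by (auto simp: h_def intro!: image_eqI[of _ _ a])
    next
      case (Inr y)
      then have "y \<in> k ` F"
        using that kF(1) by (auto simp: vJ)
      then obtain a where "a \<in> F" "y = k a"
        by auto
      then show ?thesis
        using Inr F0 by (auto simp: h_def intro!: image_eqI[of _ _ a])
    qed
    moreover have "h a \<in> pverts ?J" if "a \<noteq> 0" for a
      using that kF(1) zd[of a] by (auto simp: vJ h_def)
    ultimately show "h ` (UNIV - {0}) = pverts ?J"
      by auto
  qed
  moreover have "(h a, h b) \<in> parcs ?J \<longleftrightarrow> (a, b) \<in> parcs ?G" if ab: "a \<noteq> 0" "b \<noteq> 0" for a b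
  proof -
    have G: "(a, b) \<in> parcs ?G \<longleftrightarrow> a \<noteq> b \<and> c a * c b \<noteq> 0"
      using ab skel by (simp add: nonzero_component_graph_def)
    have kFt: "k x \<in> Field t" if "x \<in> F" for x
      using kF(1) that by auto
    have k_eq: "k a = k b \<longleftrightarrow> a = b" if "a \<in> F" "b \<in> F"
      using kF(2) that by (auto simp: inj_on_def)
    have full': "c a * c b \<noteq> 0" if "b \<in> F"
      using full[OF that ab(1)] by (simp add: mult.commute)
    note J = graph_join_def graph_complement_def zero_divisor_graph_def complete_graph_def
    show ?thesis
    \<comment> \<open>The cases match the four kinds of arcs of the join. If \<open>a\<close> or
      \<open>b\<close> is full, both sides only say that \<open>a\<close> and \<open>b\<close>
      differ; otherwise complementing turns "product zero" into "product nonzero".\<close>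
    proof (cases "a \<in> F"; cases "b \<in> F")
      assume "a \<in> F" "b \<in> F"
      then show ?thesis
        unfolding G using ab full[of a b] k_eq kFt by (simp add: J h_def)
    next
      assume "a \<in> F" "b \<notin> F"
      then show ?thesis
        unfolding G using ab full[of a b] kFt[of a] zd[of b] by (auto simp: J h_def)
    next
      assume "a \<notin> F" "b \<in> F"
      then show ?thesis
        unfolding G using ab full' kFt[of b] zd[of a] by (auto simp: J h_def)
    next
      assume "a \<notin> F" "b \<notin> F"
      then show ?thesis
        unfolding G using ab zd[of a] zd[of b] by (auto simp: J h_def c_eq)
    qed
  qed
  moreover have "pair_wf_digraph ?G" "pair_wf_digraph ?J"
    by (intro pair_sym_digraph.axioms(1) pair_bidirected_digraph.axioms(1)
        simple_nonzero_component_graph simple_graph_join simple_graph_complement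
        simple_zero_divisor_graph simple_complete_graph)+
  ultimately show ?thesis
    by (intro digraph_iso_with_projI[where h = h]) (auto simp: nonzero_component_graph_def)
qed

theorem theorem3p5:
  fixes smul :: "'f::field \<Rightarrow> 'v::ab_group_add \<Rightarrow> 'v"
    and v :: "'n::finite \<Rightarrow> 'v"
    and t :: "'t rel"
  assumes "vector_space smul"
    and "inj v"
    and "\<not> module.dependent smul (range v)"
    and "module.span smul (range v) = UNIV"
    and "Card_order t"
    and "t =o |full_vectors smul v|"
  shows "t =o cpred |UNIV :: 'f set| ^c |UNIV :: 'n set| \<and>
    digraph_iso
      (with_proj (nonzero_component_graph smul v))
      (with_proj (graph_join
        (graph_complement (zero_divisor_graph :: ('f ^ 'n) pair_pre_digraph))
        (complete_graph t)))"
proof (rule conjI)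
  note bij = bij_coordinates[OF assms(1-4)]
  show "t =o cpred |UNIV :: 'f set| ^c |UNIV :: 'n set|"
    using ordIso_transitive[OF assms(6) card_of_full_vectors[OF bij]] .
  \<comment> \<open>The complete graph has vertex set \<open>Field t\<close>, so the cardinal
    \<open>t\<close> is traded for the cardinality of its field.\<close>
  have "|full_vectors smul v| =o |Field t|"
    using assms(5,6) card_of_Field_ordIso ordIso_symmetric ordIso_transitive by blast
  then obtain k where "bij_betw k (full_vectors smul v) (Field t)"
    using card_of_ordIso by blast
  then show "digraph_iso
      (with_proj (nonzero_component_graph smul v))
      (with_proj (graph_join
        (graph_complement (zero_divisor_graph :: ('f ^ 'n) pair_pre_digraph))
        (complete_graph t)))"
    using nonzero_component_graph_iso_join[OF assms(1,2) bij] by blast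
qed

end
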